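(* There is an absolute constant $C>0$ such that the following holds. Let $x\in[0,1)^{d+1}$ (indexed $x_0,\ldots,x_d$) with $\sum_{i=0}^dx_i=1$. Then there exists an integer $K$ with $1<K\le 2^{2^{Cd}}$ such that $\mathrm{Level}(Kx)=\sum_{i=0}^d\{Kx_i\}=1$.
   Context: For $v\in\mathbb{R}$, $\{v\}=v-\lfloor v\rfloor$ is the fractional part. For $y\in\mathbb{R}^{d+1}$, $\mathrm{Level}(y)=\sum_{i=0}^d\{y_i\}$. *)

theory Defs
  imports Complex_Main
begin

text \<open>
  A point \<open>y\<close> of real \<open>(d+1)\<close>-space is a function \<open>nat \<Rightarrow> real\<close> of which only the
  coordinates \<open>0, \<dots>, d\<close> matter, so that constants can be quantified uniformly in \<open>d\<close>.
\<close>

definition Level :: "nat \<Rightarrow> (nat \<Rightarrow> real) \<Rightarrow> real" where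
  "Level d y = (\<Sum>i = 0..d. frac (y i))"

end

theory Submission
  imports Defs "HOL-Library.FuncSet"
begin

text \<open>
  If \<open>q x\<^sub>i\<close> differs from an integer by \<open>\<epsilon>\<^sub>i \<ge> - x\<^sub>i / 2\<close> for every \<open>i\<close>, and the \<open>\<epsilon>\<^sub>i\<close> sum to less
  than \<open>1\<close>, then their sum, an integer, is \<open>0\<close>, and \<open>K = q + 1\<close> works because \<open>K x\<close> is congruent to
  the point \<open>x + \<epsilon>\<close> of the simplex.  A pigeonhole argument with accuracy \<open>x\<^sub>i / 2\<close> in coordinate \<open>i\<close>
  gives such a \<open>q\<close> of size about \<open>1 / (\<Prod>i\<in>S. x\<^sub>i)\<close> for the coordinates in a set \<open>S\<close>; a coordinate
  outside \<open>S\<close> does no harm if it is so small that \<open>\<epsilon>\<^sub>i = q x\<^sub>i\<close> is small, that is, if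
  \<open>x\<^sub>i < c (\<Prod>i\<in>S. x\<^sub>i)\<close>.  Enlarging \<open>S\<close> greedily as long as this fails roughly squares the product
  at each step, which happens at most \<open>d + 1\<close> times; hence the doubly exponential bound.
\<close>

text \<open>Dirichlet's pigeonhole with a separate accuracy per coordinate: cut the unit cube into
  boxes of side \<open>1 / m i\<close> in direction \<open>i\<close>. Of the \<open>N + 1\<close>
  multiples \<open>0, ..., N\<close> of \<open>x\<close> modulo 1, two share one of the
  \<open>N\<close> boxes, and their difference gives \<open>q\<close>.\<close>

lemma weighted_simultaneous_approximation:
  fixes x :: "'a \<Rightarrow> real" and m :: "'a \<Rightarrow> nat"
  assumes "finite S" and m: "\<And>i. i \<in> S \<Longrightarrow> m i > 0"
  obtains q :: nat and p :: "'a \<Rightarrow> int"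
  where "0 < q" "q \<le> (\<Prod>i\<in>S. m i)"
    "\<And>i. i \<in> S \<Longrightarrow> \<bar>real q * x i - of_int (p i)\<bar> < 1 / real (m i)"
proof -
  define N where "N = (\<Prod>i\<in>S. m i)"
  define f where "f q = restrict (\<lambda>i. nat \<lfloor>real (m i) * frac (real q * x i)\<rfloor>) S" for q :: nat
  have cell: "nat \<lfloor>real (m i) * frac (real q * x i)\<rfloor> < m i" if "i \<in> S" for i q
  proof -
    have "real (m i) * frac (real q * x i) < real (m i)"
      using m[OF that] frac_lt_1[of "real q * x i"] by simp
    then show ?thesis
      using m[OF that] by (simp add: nat_less_iff floor_less_iff)
  qed
  let ?T = "PiE S (\<lambda>i. {..<m i})"
  have fT: "f ` {0..N} \<subseteq> ?T"
    using cell by (auto simp: f_def)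
  have "card ?T = N"
    using assms(1) by (simp add: card_PiE N_def)
  moreover have "finite ?T"
    using assms(1) by (simp add: finite_PiE)
  ultimately have "card (f ` {0..N}) < card {0..N}"
    using card_mono[OF _ fT] by simp
  then have "\<not> inj_on f {0..N}"
    by (rule pigeonhole)
  then obtain a' b' where ab': "a' \<le> N" "b' \<le> N" "a' \<noteq> b'" "f a' = f b'"
    by (auto simp: inj_on_def)
  \<comment> \<open>Ordering the two indices makes the natural subtraction \<open>b - a\<close>
    exact and positive.\<close>
  define a b where "a = min a' b'" and "b = max a' b'"
  then have ab: "a < b" "b \<le> N" "f a = f b"
    using ab' by (cases "a' < b'"; simp)+
  \<comment> \<open>With this choice the error is exactly the difference of the two fractional
    parts.\<close>
  define p where "p i = \<lfloor>real b * x i\<rfloor> - \<lfloor>real a * x i\<rfloor>" for i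
  have "\<bar>real (b - a) * x i - of_int (p i)\<bar> < 1 / real (m i)" if i: "i \<in> S" for i
  proof -
    let ?u = "real (m i) * frac (real a * x i)" and ?v = "real (m i) * frac (real b * x i)"
    have "nat \<lfloor>?u\<rfloor> = nat \<lfloor>?v\<rfloor>"
      using fun_cong[OF ab(3), of i] i unfolding f_def by (simp only: restrict_apply if_True)
    moreover have "0 \<le> ?u" "0 \<le> ?v"
      by (simp_all add: frac_ge_0)
    ultimately have "\<lfloor>?u\<rfloor> = \<lfloor>?v\<rfloor>"
      by (metis eq_nat_nat_iff zero_le_floor)
    then have "\<bar>?v - ?u\<bar> < 1"
      by linarith
    moreover have "?v - ?u = real (m i) * (real (b - a) * x i - of_int (p i))"
      using ab(1) by (simp add: frac_def p_def of_nat_diff algebra_simps)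
    ultimately have "real (m i) * \<bar>real (b - a) * x i - of_int (p i)\<bar> < 1"
      by (simp add: abs_mult)
    then show ?thesis
      using m[OF i] by (simp add: pos_less_divide_eq mult.commute)
  qed
  then show thesis
    using ab that[of "b - a" p] by (auto simp: N_def)
qed

text \<open>A \<open>good\<close> set of greatest cardinality replaces the greedy iteration. If some
  \<open>i\<close> outside it violated the gap, adding \<open>i\<close> would multiply
  \<open>c * (\<Prod>i\<in>S. x i)\<close> by a factor at least as large as itself; this at worst
  squares the quantity, just as the exponent \<open>2 ^ card S\<close> doubles, so the larger set
  would be \<open>good\<close> too.\<close>

lemma greedy_gap_set:
  fixes x :: "'a \<Rightarrow> real"
  assumes "finite I" "0 < c" "c \<le> 1"
  obtains S where "S \<subseteq> I" "\<And>i. i \<in> S \<Longrightarrow> 0 < x i"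
    "c ^ 2 ^ card I \<le> c * (\<Prod>i\<in>S. x i)"
    "\<And>i. i \<in> I - S \<Longrightarrow> x i < c * (\<Prod>i\<in>S. x i)"
proof -
  define good where "good S \<longleftrightarrow> S \<subseteq> I \<and> (\<forall>i\<in>S. 0 < x i) \<and>
    c ^ 2 ^ card S \<le> c * (\<Prod>i\<in>S. x i)" for S
  have "good {}"
    by (simp add: good_def)
  moreover have "\<forall>S. good S \<longrightarrow> card S < Suc (card I)"
    using assms(1) by (auto simp: good_def card_mono less_Suc_eq_le)
  ultimately obtain S where S: "good S" and max: "\<And>T. good T \<Longrightarrow> card T \<le> card S"
    using ex_has_greatest_nat[of good "{}" card "Suc (card I)"] by auto
  have fin: "finite S"
    using S assms(1) finite_subset by (auto simp: good_def)
  have pos: "0 < c * (\<Prod>i\<in>S. x i)"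
    using S assms(2) by (auto simp: good_def intro!: mult_pos_pos prod_pos)
  have "x i < c * (\<Prod>i\<in>S. x i)" if i: "i \<in> I - S" for i
  proof (rule ccontr)
    assume "\<not> x i < c * (\<Prod>i\<in>S. x i)"
    then have big: "c * (\<Prod>i\<in>S. x i) \<le> x i"
      by simp
    have "c ^ 2 ^ card (insert i S) = (c ^ 2 ^ card S)\<^sup>2"
      using i fin by (simp add: power_mult[symmetric] mult.commute)
    also have "\<dots> \<le> (c * (\<Prod>i\<in>S. x i))\<^sup>2"
      using S assms(2) by (intro power_mono) (auto simp: good_def)
    also have "\<dots> \<le> x i * (c * (\<Prod>i\<in>S. x i))"
      unfolding power2_eq_square using big pos by (intro mult_right_mono) auto
    also have "\<dots> = c * (\<Prod>i\<in>insert i S. x i)"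
      using i fin by simp
    finally have "good (insert i S)"
      using S i big pos by (auto simp: good_def)
    then show False
      using max[of "insert i S"] i fin by simp
  qed
  moreover have "c ^ 2 ^ card I \<le> c * (\<Prod>i\<in>S. x i)"
  proof -
    have "card S \<le> card I"
      using S assms(1) by (auto simp: good_def card_mono)
    then have "c ^ 2 ^ card I \<le> c ^ 2 ^ card S"
      using assms by (intro power_decreasing power_increasing) auto
    then show ?thesis
      using S by (auto simp: good_def)
  qed
  ultimately show thesis
    using S that[of S] by (auto simp: good_def)
qed

lemma Level_eq_1I:
  fixes x e :: "nat \<Rightarrow> real" and p :: "nat \<Rightarrow> int"
  assumes x: "\<And>i. i \<le> d \<Longrightarrow> 0 \<le> x i" "\<And>i. i \<le> d \<Longrightarrow> x i < 1" "(\<Sum>i = 0..d. x i) = 1"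
    and e: "\<And>i. i \<le> d \<Longrightarrow> of_int q * x i = of_int (p i) + e i"
    and lower: "\<And>i. i \<le> d \<Longrightarrow> - (x i / 2) \<le> e i"
    and upper: "(\<Sum>i = 0..d. e i) < 1"
  shows "Level d (\<lambda>i. of_int (q + 1) * x i) = 1"
proof -
  have "of_int q = (\<Sum>i = 0..d. of_int q * x i)"
    using x(3) by (simp add: sum_distrib_left[symmetric])
  also have "\<dots> = of_int (\<Sum>i = 0..d. p i) + (\<Sum>i = 0..d. e i)"
    by (simp add: e sum.distrib)
  finally have int: "(\<Sum>i = 0..d. e i) = of_int (q - (\<Sum>i = 0..d. p i))"
    by simp
  have "- (1 / 2) = (\<Sum>i = 0..d. - (x i / 2))"
    using x(3) by (simp add: sum_negf sum_divide_distrib[symmetric])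
  also have "\<dots> \<le> (\<Sum>i = 0..d. e i)"
    by (intro sum_mono lower) simp
  finally have "of_int (- 1) < (\<Sum>i = 0..d. e i)" "(\<Sum>i = 0..d. e i) < of_int 1"
    using upper by simp_all
  then have "q - (\<Sum>i = 0..d. p i) = 0"
    unfolding int of_int_less_iff by linarith
  then have "(\<Sum>i = 0..d. e i) = 0"
    unfolding int by simp
  then have sum: "(\<Sum>i = 0..d. x i + e i) = 1"
    using x(3) by (simp add: sum.distrib)
  have half: "x i / 2 \<le> x i + e i" "0 \<le> x i + e i" if "i \<le> d" for i
    using lower[OF that] x(1)[OF that] by linarith+
  \<comment> \<open>No upper bound on a single \<open>e i\<close> is assumed: the other coordinates
    keep at least half of their total \<open>1 - x i\<close>, which is positive, so coordinate
    \<open>i\<close> stays below 1.\<close>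
  have lt: "x i + e i < 1" if i: "i \<le> d" for i
  proof -
    let ?R = "{0..d} - {i}"
    have "(\<Sum>j\<in>?R. x j) = 1 - x i"
      using x(3) i by (subst sum_diff1) auto
    then have "0 < (\<Sum>j\<in>?R. x j / 2)"
      using x(2)[OF i] by (simp add: sum_divide_distrib[symmetric])
    also have "\<dots> \<le> (\<Sum>j\<in>?R. x j + e j)"
      by (intro sum_mono half) auto
    also have "\<dots> = 1 - (x i + e i)"
      using sum i by (subst sum_diff1) auto
    finally show ?thesis
      by simp
  qed
  have "frac (of_int (q + 1) * x i) = x i + e i" if "i \<le> d" for i
  proof -
    have "of_int (q + 1) * x i = (x i + e i) + of_int (p i)"
      using e[OF that] by (simp add: algebra_simps)
    then show ?thesis
      using half[OF that] lt[OF that] by (simp add: frac_eq frac_unique_iff)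
  qed
  then show ?thesis
    using sum by (simp add: Level_def)
qed

text \<open>The errors on \<open>S\<close> total at most 1/2, being at most \<open>x i / 2\<close>
  each. The value of \<open>c\<close> turns the bound \<open>q \<le> 4 ^ (d + 1) / X\<close> into an
  error below \<open>1 / (2 * real (d + 1))\<close> for each coordinate outside \<open>S\<close>, so
  the grand total is below 1.\<close>

lemma small_multiplier:
  fixes x :: "nat \<Rightarrow> real" and d :: nat
  defines "c \<equiv> 1 / (2 * real (d + 1) * 4 ^ (d + 1))"
  assumes x: "\<And>i. i \<le> d \<Longrightarrow> 0 \<le> x i" "\<And>i. i \<le> d \<Longrightarrow> x i < 1" "(\<Sum>i = 0..d. x i) = 1"
  obtains q :: nat where "0 < q" "real q \<le> 4 ^ (d + 1) / c ^ 2 ^ (d + 1)"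
    "Level d (\<lambda>i. of_int (int q + 1) * x i) = 1"
proof -
  have "1 * 1 \<le> 2 * real (d + 1) * 4 ^ (d + 1)"
    by (intro mult_mono one_le_power) auto
  then have c: "0 < c" "c \<le> 1"
    by (simp_all add: c_def field_simps)
  obtain S where S: "S \<subseteq> {0..d}" "\<And>i. i \<in> S \<Longrightarrow> 0 < x i"
    and P: "c ^ 2 ^ card {0..d} \<le> c * (\<Prod>i\<in>S. x i)"
    and gap: "\<And>i. i \<in> {0..d} - S \<Longrightarrow> x i < c * (\<Prod>i\<in>S. x i)"
    using greedy_gap_set[of "{0..d}" c x] c by auto
  define X where "X = (\<Prod>i\<in>S. x i)"
  have fin: "finite S" and card: "card S \<le> d + 1"
    using S(1) finite_subset card_mono[OF _ S(1)] by auto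
  have X: "0 < X"
    unfolding X_def by (intro prod_pos) (use S in auto)
  \<comment> \<open>Accuracy \<open>1 / m i \<le> x i / 2\<close> is needed; rounding up adds less
    than 1, which \<open>4 / x i\<close> absorbs because \<open>x i < 1\<close>.\<close>
  define m where "m i = nat \<lceil>2 / x i\<rceil>" for i
  have m: "0 < m i" "2 / x i \<le> real (m i)" "real (m i) \<le> 4 / x i" if "i \<in> S" for i
  proof -
    have i: "0 < x i" "x i < 1"
      using S that x(2)[of i] by auto
    then have "0 < 2 / x i" "2 / x i + 1 \<le> 4 / x i"
      by (simp_all add: field_simps)
    then show "0 < m i" "2 / x i \<le> real (m i)" "real (m i) \<le> 4 / x i"
      unfolding m_def by linarith+
  qed
  obtain q p where q: "0 < q" "q \<le> (\<Prod>i\<in>S. m i)"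
    and p: "\<And>i. i \<in> S \<Longrightarrow> \<bar>real q * x i - of_int (p i)\<bar> < 1 / real (m i)"
    using weighted_simultaneous_approximation[of S m x] fin m(1) by metis
  have "real q \<le> (\<Prod>i\<in>S. real (m i))"
    using q(2) by (metis of_nat_le_iff of_nat_prod)
  also have "\<dots> \<le> (\<Prod>i\<in>S. 4 / x i)"
    by (intro prod_mono) (use m in auto)
  also have "\<dots> = 4 ^ card S / X"
    by (simp add: prod_dividef X_def)
  also have "\<dots> \<le> 4 ^ (d + 1) / X"
    using X card by (intro divide_right_mono power_increasing) auto
  finally have qX: "real q \<le> 4 ^ (d + 1) / X" .
  \<comment> \<open>Outside \<open>S\<close> the nearby integer is 0, so the error there is
    \<open>q * x i\<close> itself, which is nonnegative.\<close>
  define p' where "p' i = (if i \<in> S then p i else 0)" for i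
  define e where "e i = real q * x i - of_int (p' i)" for i
  have eS: "\<bar>e i\<bar> \<le> x i / 2" if "i \<in> S" for i
  proof -
    have "1 / real (m i) \<le> x i / 2"
      using m[OF that] S(2)[OF that] by (simp add: field_simps)
    then show ?thesis
      using p[OF that] that by (simp add: e_def p'_def)
  qed
  have eC: "0 \<le> e i" "e i < 1 / (2 * real (d + 1))" if "i \<in> {0..d} - S" for i
  proof -
    show "0 \<le> e i"
      using that x(1)[of i] by (simp add: e_def p'_def)
    have "e i = real q * x i"
      using that by (simp add: e_def p'_def)
    also have "\<dots> < real q * (c * X)"
      using gap[OF that] q(1) by (simp add: X_def)
    also have "\<dots> \<le> 4 ^ (d + 1) / X * (c * X)"
      using qX X c by (intro mult_right_mono) auto
    also have "\<dots> = 1 / (2 * real (d + 1))"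
      using X by (simp add: c_def)
    finally show "e i < 1 / (2 * real (d + 1))" .
  qed
  \<comment> \<open>One strict bound covers both kinds of coordinates, and its right-hand sides sum
    to exactly 1.\<close>
  have bound: "e i < x i / 2 + 1 / (2 * real (d + 1))" if "i \<in> {0..d}" for i
  proof (cases "i \<in> S")
    case True
    have "0 < 1 / (2 * real (d + 1))"
      by simp
    then show ?thesis
      using eS[OF True] by linarith
  next
    case False
    then show ?thesis
      using eC[of i] x(1)[of i] that by auto
  qed
  have "(\<Sum>i = 0..d. e i) < (\<Sum>i = 0..d. x i / 2 + 1 / (2 * real (d + 1)))"
    by (intro sum_strict_mono bound) auto
  also have "\<dots> = (\<Sum>i = 0..d. x i) / 2 + real (d + 1) * (1 / (2 * real (d + 1)))"
    by (simp add: sum.distrib sum_divide_distrib)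
  also have "\<dots> = 1"
    using x(3) by (simp add: field_simps)
  finally have upper: "(\<Sum>i = 0..d. e i) < 1" .
  have lower: "- (x i / 2) \<le> e i" if "i \<le> d" for i
    using eS[of i] eC(1)[of i] x(1)[OF that] that by (cases "i \<in> S") auto
  have "Level d (\<lambda>i. of_int (int q + 1) * x i) = 1"
    by (rule Level_eq_1I[where p = p' and e = e, OF x _ lower upper]) (auto simp: e_def)
  moreover have "c * X \<le> X"
    using X c by (intro mult_left_le_one_le) auto
  then have "c ^ 2 ^ (d + 1) \<le> X"
    using P by (simp add: X_def)
  then have "4 ^ (d + 1) / X \<le> 4 ^ (d + 1) / c ^ 2 ^ (d + 1)"
    using c by (intro divide_left_mono mult_pos_pos X) auto
  ultimately show thesis
    using that[of q] q(1) qX by linarith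
qed

text \<open>The summand 1 accounts for \<open>K = q + 1\<close>. With \<open>D = d + 1\<close>, the
  binary exponent of the left side is at most \<open>2 ^ (3 + 2 * D)\<close>, and
  \<open>3 + 2 * D = 2 * d + 5 \<le> 7 * d\<close> once \<open>d \<ge> 1\<close>; hence the constant
  7.\<close>

lemma multiplier_bound:
  assumes "d > 0"
  shows "4 ^ (d + 1) / (1 / (2 * real (d + 1) * 4 ^ (d + 1))) ^ 2 ^ (d + 1) + 1
    \<le> 2 powr (2 powr (7 * real d))"
proof -
  define D where "D = d + 1"
  have D: "D < 2 ^ D" "2 \<le> D"
    using assms less_exp[of D] by (simp_all add: D_def)
  have four: "(4::real) ^ n = 2 ^ (2 * n)" for n
    by (simp add: power_mult)
  have "real D \<le> 2 ^ D"
    using D(1) by (metis less_imp_le of_nat_le_iff of_nat_numeral of_nat_power)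
  then have "2 * real D * 4 ^ D \<le> 2 * 2 ^ D * 4 ^ D"
    by simp
  also have "\<dots> = 2 ^ (1 + 3 * D)"
    by (simp add: four power_add[symmetric])
  also have "\<dots> \<le> 2 ^ (4 * D)"
    using D by (intro power_increasing) auto
  finally have "(2 * real D * 4 ^ D) ^ 2 ^ D \<le> (2 ^ (4 * D)) ^ 2 ^ D"
    by (intro power_mono) auto
  then have "4 ^ D * (2 * real D * 4 ^ D) ^ 2 ^ D \<le> 2 ^ (2 * D) * (2 ^ (4 * D)) ^ 2 ^ D"
    by (simp add: four)
  also have "\<dots> = 2 ^ (2 * D + 4 * D * 2 ^ D)"
    by (simp add: power_add power_mult)
  finally have "4 ^ D * (2 * real D * 4 ^ D) ^ 2 ^ D + 1 \<le> 2 ^ (2 * D + 4 * D * 2 ^ D) + (1::real)"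
    by simp
  also have "\<dots> \<le> 2 ^ (1 + (2 * D + 4 * D * 2 ^ D))"
    using one_le_power[of "2::real" "2 * D + 4 * D * 2 ^ D"] by (simp add: power_add)
  also have "\<dots> \<le> 2 ^ 2 ^ (7 * d)"
  proof (rule power_increasing)
    have "1 + 2 * D \<le> 4 * D * 1"
      using D by simp
    also have "\<dots> \<le> 4 * D * 2 ^ D"
      by (intro mult_left_mono) auto
    finally have "1 + (2 * D + 4 * D * 2 ^ D) \<le> 8 * D * 2 ^ D"
      by simp
    also have "\<dots> \<le> 8 * 2 ^ D * 2 ^ D"
      using less_imp_le[OF D(1)] by (intro mult_right_mono mult_left_mono) simp_all
    also have "\<dots> = 2 ^ (3 + 2 * D)"
      by (simp add: power_add power_even_eq power2_eq_square)
    also have "\<dots> \<le> 2 ^ (7 * d)"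
      using assms by (intro power_increasing) (auto simp: D_def)
    finally show "1 + (2 * D + 4 * D * 2 ^ D) \<le> 2 ^ (7 * d)" .
  qed simp
  also have "(2::real) ^ 2 ^ (7 * d) = 2 powr (2 powr (7 * real d))"
    using powr_realpow[of "2::real" "7 * d"] powr_realpow[of "2::real" "2 ^ (7 * d)"] by simp
  finally show ?thesis
    by (simp add: D_def power_one_over)
qed

theorem theorem7:
  "\<exists>C::real. C > 0 \<and>
    (\<forall>(d::nat) (x :: nat \<Rightarrow> real).
      (\<forall>i\<in>{0..d}. x i \<in> {0..<1}) \<and> (\<Sum>i = 0..d. x i) = 1 \<longrightarrow>
      (\<exists>K::int. 1 < K \<and> real_of_int K \<le> 2 powr (2 powr (C * real d)) \<and>
        Level d (\<lambda>i. real_of_int K * x i) = 1))"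
proof (rule exI[of _ 7], intro conjI allI impI)
  fix d :: nat and x :: "nat \<Rightarrow> real"
  assume "(\<forall>i\<in>{0..d}. x i \<in> {0..<1}) \<and> (\<Sum>i = 0..d. x i) = 1"
  then have x: "\<And>i. i \<le> d \<Longrightarrow> 0 \<le> x i" "\<And>i. i \<le> d \<Longrightarrow> x i < 1" "(\<Sum>i = 0..d. x i) = 1"
    by auto
  \<comment> \<open>For \<open>d = 0\<close> the sum condition would force \<open>x 0 = 1\<close>,
    contrary to \<open>x 0 < 1\<close>.\<close>
  have "d > 0"
    using x(2)[of 0] x(3) by (cases d) auto
  obtain q :: nat where q: "0 < q"
    "real q \<le> 4 ^ (d + 1) / (1 / (2 * real (d + 1) * 4 ^ (d + 1))) ^ 2 ^ (d + 1)"
    "Level d (\<lambda>i. of_int (int q + 1) * x i) = 1"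
    using small_multiplier[OF x] by blast
  have "real_of_int (int q + 1) \<le> 2 powr (2 powr (7 * real d))"
    using q(2) multiplier_bound[OF \<open>d > 0\<close>] by simp
  then show "\<exists>K::int. 1 < K \<and> real_of_int K \<le> 2 powr (2 powr (7 * real d)) \<and>
      Level d (\<lambda>i. real_of_int K * x i) = 1"
    using q by (intro exI[of _ "int q + 1"]) simp
qed simp

end
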